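(* Let $\kappa(n, m, r)$ denote the maximum of $|\mathcal{K}^m(T)|$ over all labeled graphs $(G, L, f)$ with $|L| \leq r$ and over all sets of terminals $T = \{v_1, v_2, \ldots, v_n\} \subseteq V(G)$, i.e., the maximum number of distinct cut characteristics induced by separators of at most $m$ vertices in an $n$-terminal graph labeled with $r$ different labels. Then $$\kappa(n, m, r) \in \mathcal{O}\left(m^{2n} \cdot r^{nm(m+3)/2} \cdot 4^{nm}\right),$$ which is polynomial in $r$ for fixed $n, m$.
   Context: All graphs are simple, undirected and finite. A labeled graph is a tuple $(G, L, f)$ where $G$ is a graph, $L$ is a finite set of labels, and $f \colon V(G) \to 2^L$ assigns to each vertex a (possibly empty) subset of the labels. For $S \subseteq V(G)$ and a terminal $t \in V(G)$, $R(t, S)$ denotes the set of vertices of $V(G) \setminus S$ reachable from $t$ in $G - S$ (empty if $t\in S$), and $\mathcal{L}(t, S) := \bigcup_{v \in R(t, S)} f(v)$ is the set of labels reachable from $t$ in $G-S$. For a sequence $T = t_1, \ldots, t_n$ of distinct terminal vertices in $G$ (a set of terminals is ordered arbitrarily), the cut characteristic of $S \subseteq V(G)$ with respect to $T$ is the vector $\mathcal{K}(S, T) := (\mathcal{L}(t_1, S), \mathcal{L}(t_2, S), \ldots, \mathcal{L}(t_n, S))$. For $m\geq 1$, $\mathcal{K}^m(T) := \{ \mathcal{K}(S, T) \mid S \subseteq V(G), |S|\leq m \}$. *)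

theory Defs
  imports
    "HOL-Library.Landau_Symbols"
    "HOL-Computational_Algebra.Polynomial"
    "Graph_Theory.Graph_Theory"
begin

text \<open>A \<^locale>\<open>pair_graph\<close> is a finite, symmetric, loop-free digraph whose arcs are pairs of
  vertices, that is, a finite simple undirected graph.\<close>

definition labeled_graph :: "'v pair_pre_digraph \<Rightarrow> 'l set \<Rightarrow> ('v \<Rightarrow> 'l set) \<Rightarrow> bool" where
  "labeled_graph G L f \<longleftrightarrow> pair_graph G \<and> finite L \<and> (\<forall>v\<in>pverts G. f v \<subseteq> L)"

text \<open>The library's reachability is confined to the vertices of the graph, also for the empty
  walk, so the following set is empty if \<open>t \<in> S\<close>.\<close>

definition reach_verts :: "'v pair_pre_digraph \<Rightarrow> 'v \<Rightarrow> 'v set \<Rightarrow> 'v set" where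
  "reach_verts G t S = {v. t \<rightarrow>\<^sup>*\<^bsub>with_proj G \<restriction> (pverts G - S)\<^esub> v}"

definition reach_labels ::
  "'v pair_pre_digraph \<Rightarrow> ('v \<Rightarrow> 'l set) \<Rightarrow> 'v \<Rightarrow> 'v set \<Rightarrow> 'l set" where
  "reach_labels G f t S = (\<Union>v\<in>reach_verts G t S. f v)"

definition cut_characteristic ::
  "'v pair_pre_digraph \<Rightarrow> ('v \<Rightarrow> 'l set) \<Rightarrow> 'v set \<Rightarrow> 'v list \<Rightarrow> 'l set list" where
  "cut_characteristic G f S T = map (\<lambda>t. reach_labels G f t S) T"

definition cut_characteristics ::
  "'v pair_pre_digraph \<Rightarrow> ('v \<Rightarrow> 'l set) \<Rightarrow> nat \<Rightarrow> 'v list \<Rightarrow> 'l set list set" where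
  "cut_characteristics G f m T =
     {cut_characteristic G f S T | S. S \<subseteq> pverts G \<and> card S \<le> m}"

text \<open>Vertices and labels are natural numbers here, so that the maximum is over a set. As
  all graphs and label sets are finite, this is no restriction: see
  \<open>card_cut_characteristics_le_kappa\<close> below.\<close>

definition cut_characteristic_counts :: "nat \<Rightarrow> nat \<Rightarrow> nat \<Rightarrow> nat set" where
  "cut_characteristic_counts n m r =
     {card (cut_characteristics G f m T) | (G :: nat pair_pre_digraph) (L :: nat set) f T.
        labeled_graph G L f \<and> card L \<le> r \<and> distinct T \<and> set T \<subseteq> pverts G \<and> length T = n}"

definition kappa :: "nat \<Rightarrow> nat \<Rightarrow> nat \<Rightarrow> nat" where
  "kappa n m r = Max (cut_characteristic_counts n m r)"

lemma reach_verts_subset: "reach_verts G t S \<subseteq> pverts G - S"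
  unfolding reach_verts_def reachable_def by (auto dest: in_rtrancl_on_in_F)

lemma card_cut_characteristics_le:
  assumes "labeled_graph G L f" "card L \<le> r" "length T = n"
  shows "card (cut_characteristics G f m T) \<le> (2 ^ r) ^ n"
proof -
  have fin: "finite (Pow L)" and sub: "\<And>v. v \<in> pverts G \<Longrightarrow> f v \<subseteq> L"
    using assms(1) by (auto simp: labeled_graph_def)
  have "cut_characteristics G f m T \<subseteq> {xs. set xs \<subseteq> Pow L \<and> length xs = n}"
    using assms(3) sub reach_verts_subset[of G]
    by (fastforce simp: cut_characteristics_def cut_characteristic_def reach_labels_def)
  then have "card (cut_characteristics G f m T) \<le> card {xs. set xs \<subseteq> Pow L \<and> length xs = n}"
    by (intro card_mono finite_lists_length_eq fin)
  also have "\<dots> = card (Pow L) ^ n"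
    by (rule card_lists_length_eq[OF fin])
  also have "\<dots> \<le> (2 ^ r) ^ n"
    using assms(1,2) by (intro power_mono) (auto simp: card_Pow labeled_graph_def)
  finally show ?thesis .
qed

lemma finite_cut_characteristic_counts: "finite (cut_characteristic_counts n m r)"
  by (rule finite_subset[of _ "{..(2 ^ r) ^ n}"])
    (auto simp: cut_characteristic_counts_def dest: card_cut_characteristics_le)

lemma cut_characteristic_counts_nonempty: "cut_characteristic_counts n m r \<noteq> {}"
proof -
  let ?G = "\<lparr>pverts = {..<n}, parcs = {}\<rparr> :: nat pair_pre_digraph"
  have "pair_graph ?G"
    by unfold_locales (auto simp: symmetric_def sym_def)
  then have "labeled_graph ?G ({} :: nat set) (\<lambda>_. {})"
    by (simp add: labeled_graph_def)
  moreover have "distinct [0..<n]" "set [0..<n] \<subseteq> pverts ?G" "length [0..<n] = n"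
    by auto
  ultimately have "card (cut_characteristics ?G (\<lambda>_. {} :: nat set) m [0..<n])
      \<in> cut_characteristic_counts n m r"
    unfolding cut_characteristic_counts_def by force
  then show ?thesis by blast
qed

lemma rtrancl_on_image:
  assumes "(a, b) \<in> rtrancl_on F E"
  shows "(h a, h b) \<in> rtrancl_on (h ` F) (map_prod h h ` E)"
  using assms
proof (induction rule: rtrancl_on_induct)
  case (step y z)
  then have "(h y, h z) \<in> map_prod h h ` E" "h z \<in> h ` F" by force+
  with step.IH show ?case by (rule rtrancl_on_into_rtrancl_on)
qed simp

lemma card_cut_characteristics_le_kappa:
  fixes G :: "'v pair_pre_digraph" and L :: "'l set"
  assumes G: "labeled_graph G L f" and L: "card L \<le> r"
    and T: "distinct T" "set T \<subseteq> pverts G" "length T = n"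
  shows "card (cut_characteristics G f m T) \<le> kappa n m r"
proof -
  interpret pair_graph G using G by (simp add: labeled_graph_def)
  have "finite (pverts G)" by (rule pair_finite_verts)
  then obtain h :: "'v \<Rightarrow> nat" where h: "inj_on h (pverts G)"
    using finite_imp_inj_to_nat_seg by metis
  have "finite L" using G by (simp add: labeled_graph_def)
  then obtain k :: "'l \<Rightarrow> nat" where k: "inj_on k L"
    using finite_imp_inj_to_nat_seg by metis
  define h' where "h' = inv_into (pverts G) h"
  have h'h: "h' (h v) = v" if "v \<in> pverts G" for v
    using h that by (simp add: h'_def)
  have fL: "f v \<subseteq> L" if "v \<in> pverts G" for v
    using G that by (simp add: labeled_graph_def)
  define G' where "G' = \<lparr>pverts = h ` pverts G, parcs = map_prod h h ` parcs G\<rparr>"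
  define f' where "f' = (\<lambda>v. k ` f (h' v))"
  have "pair_graph G'"
  proof
    fix e assume "e \<in> parcs G'"
    then obtain u v where e: "e = (h u, h v)" "(u, v) \<in> parcs G"
      by (auto simp: G'_def)
    then have uv: "u \<in> pverts G" "v \<in> pverts G" "u \<noteq> v"
      using pair_no_loops[OF e(2)] by (auto dest: in_arcsD1 in_arcsD2)
    show "fst e \<in> pverts G'" "snd e \<in> pverts G'"
      using e uv by (auto simp: G'_def)
    show "fst e \<noteq> snd e" using e uv h by (auto dest: inj_onD)
  next
    show "finite (pverts G')" "finite (parcs G')"
      using pair_finite_verts pair_finite_arcs by (simp_all add: G'_def)
    have "sym (parcs G)" using pair_sym_arcs by (simp add: symmetric_def)
    then show "symmetric (with_proj G')"
      by (force simp: symmetric_def sym_def G'_def)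
  qed
  then have lab: "labeled_graph G' (k ` L) f'"
    using \<open>finite L\<close> fL by (auto simp: labeled_graph_def G'_def f'_def h'h)
  have reach: "reach_verts G' (h t) (h ` S) = h ` reach_verts G t S"
    if t: "t \<in> pverts G" and S: "S \<subseteq> pverts G" for t S
  proof -
    let ?F = "pverts G - S" and ?E = "{e \<in> parcs G. fst e \<in> pverts G - S \<and> snd e \<in> pverts G - S}"
    let ?E' = "{e \<in> parcs G'. fst e \<in> h ` ?F \<and> snd e \<in> h ` ?F}"
    have F': "pverts G' - h ` S = h ` ?F"
      using inj_on_image_set_diff[OF h, of "pverts G" S] S by (simp add: G'_def)
    have R: "reach_verts G t S = {v. (t, v) \<in> rtrancl_on ?F ?E}"
      by (simp add: reach_verts_def reachable_def arcs_ends_conv)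
    have R': "reach_verts G' (h t) (h ` S) = {v. (h t, v) \<in> rtrancl_on (h ` ?F) ?E'}"
      unfolding reach_verts_def F' reachable_def by (simp add: arcs_ends_conv)
    have mem: "h u \<in> h ` ?F \<longleftrightarrow> u \<in> ?F" if "u \<in> pverts G" for u
      using that by (intro inj_on_image_mem_iff[OF h]) auto
    have E': "?E' = map_prod h h ` ?E"
    proof (intro equalityI subsetI)
      fix e assume e: "e \<in> ?E'"
      then obtain u v where uv: "e = (h u, h v)" "(u, v) \<in> parcs G"
        by (auto simp: G'_def)
      then have "(u, v) \<in> ?E"
        using e mem[OF in_arcsD1[OF uv(2)]] mem[OF in_arcsD2[OF uv(2)]] by simp
      then show "e \<in> map_prod h h ` ?E" using uv(1) by (intro image_eqI[of _ _ "(u, v)"]) auto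
    next
      fix e assume "e \<in> map_prod h h ` ?E"
      then show "e \<in> ?E'" by (auto simp: G'_def)
    qed
    have inv: "h' ` h ` ?F = ?F" "map_prod h' h' ` map_prod h h ` ?E = ?E"
    proof -
      show "h' ` h ` ?F = ?F" by (simp add: image_image h'h)
      have "map_prod h' h' (map_prod h h e) = e" if "e \<in> ?E" for e
        using that by (cases e) (simp add: h'h)
      then show "map_prod h' h' ` map_prod h h ` ?E = ?E"
        by (simp add: image_image)
    qed
    show ?thesis
    proof (intro equalityI subsetI)
      fix w assume "w \<in> reach_verts G' (h t) (h ` S)"
      then have w: "(h t, w) \<in> rtrancl_on (h ` ?F) (map_prod h h ` ?E)"
        by (simp add: R' E')
      then have "(h' (h t), h' w) \<in> rtrancl_on ?F ?E"
        using rtrancl_on_image[OF w, of h'] by (simp only: inv)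
      moreover obtain u where "w = h u" "u \<in> ?F"
        using in_rtrancl_on_in_F(2)[OF w] by blast
      ultimately show "w \<in> h ` reach_verts G t S"
        using t by (simp add: R h'h)
    next
      fix w assume "w \<in> h ` reach_verts G t S"
      then show "w \<in> reach_verts G' (h t) (h ` S)"
        using rtrancl_on_image[of t _ ?F ?E h] by (auto simp: R R' E')
    qed
  qed
  have labels: "reach_labels G' f' (h t) (h ` S) = k ` reach_labels G f t S"
    if "t \<in> pverts G" "S \<subseteq> pverts G" for t S
    using that reach_verts_subset[of G t S]
    by (force simp: reach_labels_def reach f'_def h'h image_UN subset_iff)
  have char: "cut_characteristic G' f' (h ` S) (map h T) =
      map (image k) (cut_characteristic G f S T)" if "S \<subseteq> pverts G" for S
    using T(2) that by (auto simp: cut_characteristic_def labels)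
  have sub: "map (image k) ` cut_characteristics G f m T \<subseteq> cut_characteristics G' f' m (map h T)"
  proof clarify
    fix x assume "x \<in> cut_characteristics G f m T"
    then obtain S where S: "x = cut_characteristic G f S T" "S \<subseteq> pverts G" "card S \<le> m"
      by (auto simp: cut_characteristics_def)
    then have "h ` S \<subseteq> pverts G'" "card (h ` S) \<le> m"
      using h by (auto simp: G'_def card_image inj_on_subset)
    with char[OF S(2)] S(1) show "map (image k) x \<in> cut_characteristics G' f' m (map h T)"
      unfolding cut_characteristics_def by (metis (mono_tags, lifting) mem_Collect_eq)
  qed
  have "set x \<subseteq> Pow L" if "x \<in> cut_characteristics G f m T" for x
    using that fL reach_verts_subset[of G]
    by (fastforce simp: cut_characteristics_def cut_characteristic_def reach_labels_def)
  then have "inj_on (map (image k)) (cut_characteristics G f m T)"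
    using inj_on_image_Pow[OF k] by (intro inj_onI) (metis map_inj_on inj_on_subset Un_least)
  then have "card (cut_characteristics G f m T)
      = card (map (image k) ` cut_characteristics G f m T)"
    by (simp add: card_image)
  also have "\<dots> \<le> card (cut_characteristics G' f' m (map h T))"
  proof (rule card_mono[OF _ sub])
    have "finite {S. S \<subseteq> pverts G' \<and> card S \<le> m}"
      using pair_finite_verts by (simp add: G'_def)
    then show "finite (cut_characteristics G' f' m (map h T))"
      by (simp add: cut_characteristics_def)
  qed
  also have "\<dots> \<le> kappa n m r"
    unfolding kappa_def
  proof (rule Max_ge[OF finite_cut_characteristic_counts])
    have "card (k ` L) \<le> r" using L k by (simp add: card_image)
    moreover have "distinct (map h T)"
      using T(1,2) h by (auto simp: distinct_map inj_on_subset)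
    moreover have "set (map h T) \<subseteq> pverts G'" "length (map h T) = n"
      using T(2,3) by (auto simp: G'_def)
    ultimately show "card (cut_characteristics G' f' m (map h T)) \<in> cut_characteristic_counts n m r"
      using lab unfolding cut_characteristic_counts_def by blast
  qed
  finally show ?thesis .
qed

text \<open>\<open>m * (m + 3)\<close> is even, so the following division is exact.\<close>

definition kappa_bound :: "nat \<Rightarrow> nat \<Rightarrow> nat \<Rightarrow> real" where
  "kappa_bound n m r =
     real m ^ (2 * n) * real r ^ (n * m * (m + 3) div 2) * 4 ^ (n * m)"

end

theory Submission
  imports Defs
begin

text \<open>
  Since the components of a cut characteristic can be bounded separately, one terminal \<open>t\<close>
  suffices. Let \<open>A\<close> be the set reached from \<open>t\<close> and \<open>X\<close> the set of labels missed by \<open>A\<close>. Enlarging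
  \<open>A\<close> without increasing its boundary and without meeting \<open>X\<close> does not change the label set, so
  the boundary of \<open>A\<close> may be taken to be an important separator towards the vertices with a label in
  \<open>X\<close>. By submodularity of the boundary size, an inclusion-minimal \<open>X' \<subseteq> X\<close> for which \<open>A\<close> is still
  important has at most \<open>2 * m\<close> elements, and for a fixed \<open>X'\<close> there are at most \<open>4 ^ m\<close> important
  separators of size at most \<open>m\<close>. This yields at most \<open>r ^ (2 * m) * 4 ^ m\<close> label sets when
  \<open>r \<ge> 2\<close>, and \<open>2 * m \<le> m * (m + 3) div 2\<close>.
\<close>

section \<open>Boundaries of vertex sets\<close>

locale rooted_digraph =
  fixes E :: "('v \<times> 'v) set" and t :: 'v
  assumes finite_arcs: "finite E"
begin

text \<open>The root is treated as having an arc from outside, so that it may itself be a separator: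
  the boundary of the empty set is \<open>{t}\<close>.\<close>

definition bd :: "'v set \<Rightarrow> 'v set" where
  "bd A = insert t (E `` A) - A"

text \<open>This says that every vertex of \<open>A\<close> is reachable from \<open>t\<close> inside \<open>A\<close>.\<close>

definition rooted :: "'v set \<Rightarrow> bool" where
  "rooted A \<longleftrightarrow> (\<forall>C. A \<inter> bd C = {} \<longrightarrow> A \<subseteq> C)"

text \<open>\<open>B \<inter> bd C = {}\<close> says that \<open>C\<close> contains \<open>t\<close>
  if \<open>B\<close> does and is closed under arcs ending in \<open>B\<close>; the least such
  \<open>C\<close> is what \<open>t\<close> reaches inside \<open>B\<close>.\<close>

definition root_component :: "'v set \<Rightarrow> 'v set" where
  "root_component B = \<Inter>{C. B \<inter> bd C = {}}"

text \<open>Important separators, given by their reachable side. \<open>B\<close> need not be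
  rooted, so unions can be tested directly; a superset avoiding \<open>bd A\<close> only adds
  vertices that the root does not reach inside it.\<close>

definition important :: "'v set \<Rightarrow> 'v set \<Rightarrow> bool" where
  "important Y A \<longleftrightarrow> rooted A \<and> A \<inter> Y = {} \<and>
     (\<forall>B. A \<subseteq> B \<longrightarrow> B \<inter> Y = {} \<longrightarrow> B \<inter> bd A \<noteq> {} \<longrightarrow> card (bd A) < card (bd B))"

lemma finite_bd [simp]: "finite (bd A)"
  unfolding bd_def using finite_arcs by (simp add: finite_Image)

lemma bd_disjoint: "A \<inter> bd A = {}"
  by (auto simp: bd_def)

lemma bd_mono: "A \<subseteq> B \<Longrightarrow> bd A \<subseteq> B \<union> bd B"
  by (auto simp: bd_def)

text \<open>No vertex is counted more often on the left than on the right. \<open>W\<close> stands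
  for separator vertices already fixed during branching.\<close>

lemma card_bd_submodular:
  assumes "finite W"
  shows "card (bd (A \<inter> B) - W) + card (bd (A \<union> B) - W) \<le> card (bd A - W) + card (bd B - W)"
proof -
  let ?P = "bd (A \<inter> B) - W" and ?Q = "bd (A \<union> B) - W"
  have "card ?P + card ?Q = card (?P \<union> ?Q) + card (?P \<inter> ?Q)"
    by (intro card_Un_Int) auto
  also have "\<dots> \<le> card ((bd A - W) \<union> (bd B - W)) + card ((bd A - W) \<inter> (bd B - W))"
  proof (intro add_mono card_mono)
    show "?P \<union> ?Q \<subseteq> (bd A - W) \<union> (bd B - W)" "?P \<inter> ?Q \<subseteq> (bd A - W) \<inter> (bd B - W)"
      by (auto simp: bd_def)
  qed auto
  also have "\<dots> = card (bd A - W) + card (bd B - W)"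
    by (intro card_Un_Int[symmetric]) auto
  finally show ?thesis .
qed

lemma rooted_subset: "rooted A \<Longrightarrow> A \<inter> bd C = {} \<Longrightarrow> A \<subseteq> C"
  by (auto simp: rooted_def)

lemma rooted_empty: "rooted {}"
  by (simp add: rooted_def)

lemma rooted_insert:
  assumes "rooted A" "v \<in> bd A"
  shows "rooted (insert v A)"
  unfolding rooted_def
proof (intro allI impI)
  fix C assume C: "insert v A \<inter> bd C = {}"
  then have "A \<subseteq> C" by (intro rooted_subset[OF assms(1)]) auto
  with C assms(2) show "insert v A \<subseteq> C" by (auto simp: bd_def)
qed

lemma importantD:
  assumes "important Y A"
  shows "rooted A" "A \<inter> Y = {}"
    and "\<And>B. A \<subseteq> B \<Longrightarrow> B \<inter> Y = {} \<Longrightarrow> B \<inter> bd A \<noteq> {} \<Longrightarrow> card (bd A) < card (bd B)"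
  using assms unfolding important_def by blast+

lemma rooted_subset_vertices: "rooted A \<Longrightarrow> A \<subseteq> insert t (Range E)"
  by (rule rooted_subset) (auto simp: bd_def)

lemma finite_rooted: "finite {A. rooted A}"
proof (rule finite_subset)
  show "{A. rooted A} \<subseteq> Pow (insert t (Range E))"
    using rooted_subset_vertices by auto
qed (simp add: finite_arcs finite_Range)

section \<open>The part of a set reachable from the root\<close>

lemma root_component_subset: "root_component B \<subseteq> B"
  using bd_disjoint[of B] by (auto simp: root_component_def)

text \<open>The sets \<open>C\<close> with \<open>B \<inter> bd C = {}\<close> are closed under
  intersection.\<close>

lemma bd_root_component_disjoint: "B \<inter> bd (root_component B) = {}"
  unfolding root_component_def bd_def by blast

lemma bd_root_component_subset: "bd (root_component B) \<subseteq> bd B"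
  using root_component_subset[of B] bd_root_component_disjoint[of B] by (auto simp: bd_def)

lemma rooted_root_component: "rooted (root_component B)"
  unfolding rooted_def
proof (intro allI impI)
  fix C assume C: "root_component B \<inter> bd C = {}"
  have "B \<inter> bd (C \<inter> root_component B) = {}"
    using C bd_root_component_disjoint[of B] by (auto simp: bd_def)
  then show "root_component B \<subseteq> C" by (auto simp: root_component_def)
qed

lemma rooted_subset_root_component:
  assumes "rooted A" "A \<subseteq> B"
  shows "A \<subseteq> root_component B"
  using assms bd_root_component_disjoint[of B] by (intro rooted_subset) auto

section \<open>Counting important separators\<close>

text \<open>The usual branching argument: \<open>l\<close> bounds the connectivity between \<open>Z\<close> and \<open>Y\<close> after deletion of
  \<open>W\<close> from below, and the measure \<open>p\<close> is twice the remaining budget minus this connectivity.\<close>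

lemma card_important_branching:
  assumes "finite W" "rooted Z"
    and "\<And>B. Z \<subseteq> B \<Longrightarrow> B \<inter> Y = {} \<Longrightarrow> B \<inter> W = {} \<Longrightarrow> l \<le> card (bd B - W)"
    and "2 * k \<le> p + l + 2 * card W"
  shows "card {A. important Y A \<and> Z \<subseteq> A \<and> W \<subseteq> bd A \<and> card (bd A) \<le> k} \<le> 2 ^ p"
  using assms
proof (induction p arbitrary: Z W l rule: less_induct)
  case (less p)
  let ?I = "\<lambda>Z W. {A. important Y A \<and> Z \<subseteq> A \<and> W \<subseteq> bd A \<and> card (bd A) \<le> k}"
  let ?C = "\<lambda>B. rooted B \<and> Z \<subseteq> B \<and> B \<inter> Y = {} \<and> B \<inter> W = {}"
  have fin: "finite (?I Z W)" for Z W
    by (rule finite_subset[OF _ finite_rooted]) (auto simp: important_def)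
  show ?case
  proof (cases "?I Z W = {}")
    case False
    then obtain A0 where A0: "A0 \<in> ?I Z W" by auto
    then have C0: "?C A0"
      using bd_disjoint[of A0] importantD(1,2)[of Y A0] by blast
    \<comment> \<open>\<open>d\<close> is the actual connectivity, of which \<open>l\<close> is a
      lower bound; \<open>M\<close> below is an inclusion-maximal rooted set attaining it.\<close>
    define P where "P d \<longleftrightarrow> (\<exists>B. ?C B \<and> card (bd B - W) = d)" for d
    define d where "d = (LEAST d. P d)"
    define N where "N = {B. ?C B \<and> card (bd B - W) = d}"
    have "P (card (bd A0 - W))" using C0 by (auto simp: P_def)
    then have "P d" unfolding d_def by (rule LeastI)
    then have "N \<noteq> {}" by (auto simp: P_def N_def)
    have dle: "d \<le> card (bd B - W)"
      if "Z \<subseteq> B" "B \<inter> Y = {}" "B \<inter> W = {}" for B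
    proof -
      have "?C (root_component B)"
        using that root_component_subset[of B] rooted_root_component[of B]
          rooted_subset_root_component[OF less.prems(2)] by blast
      then have "P (card (bd (root_component B) - W))" by (auto simp: P_def)
      then have "d \<le> card (bd (root_component B) - W)" unfolding d_def by (rule Least_le)
      also have "\<dots> \<le> card (bd B - W)"
        using bd_root_component_subset[of B] by (intro card_mono) auto
      finally show ?thesis .
    qed
    have "finite N"
      by (rule finite_subset[OF _ finite_rooted]) (auto simp: N_def)
    then obtain M where "M \<in> N" and max: "\<And>B. B \<in> N \<Longrightarrow> M \<subseteq> B \<Longrightarrow> M = B"
      using finite_has_maximal[OF _ \<open>N \<noteq> {}\<close>] by blast
    then have M: "?C M" "card (bd M - W) = d" by (auto simp: N_def)
    have "l \<le> d" using M less.prems(3)[of M] by auto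
    \<comment> \<open>Uncrossing: \<open>A \<inter> M\<close> has boundary at least \<open>d\<close>
      outside \<open>W\<close>, so by submodularity the boundary of \<open>A \<union> M\<close> is
      no larger than that of \<open>A\<close>. Importance keeps \<open>A \<union> M\<close> off
      \<open>bd A\<close>, and \<open>M\<close> is rooted.\<close>
    have sub: "M \<subseteq> A" if A: "A \<in> ?I Z W" for A
    proof -
      have AW: "A \<inter> W = {}" "Z \<subseteq> A" "A \<inter> Y = {}" "W \<subseteq> bd A"
        using A bd_disjoint[of A] importantD(2)[of Y A] by blast+
      then have "d \<le> card (bd (A \<inter> M) - W)" using M by (intro dle) auto
      with card_bd_submodular[OF less.prems(1), of A M] M(2)
      have "card (bd (A \<union> M) - W) \<le> card (bd A - W)" by linarith
      moreover have "card (bd (A \<union> M)) \<le> card (bd (A \<union> M) - W) + card W"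
        using less.prems(1) card_Diff_subset_Int[of "bd (A \<union> M)" W]
          card_mono[of W "bd (A \<union> M) \<inter> W"] by (simp add: Int_commute)
      moreover have "card (bd A - W) + card W = card (bd A)"
        using AW(4) less.prems(1) card_mono[OF finite_bd AW(4)] by (simp add: card_Diff_subset)
      ultimately have "\<not> card (bd A) < card (bd (A \<union> M))" by linarith
      moreover have "(A \<union> M) \<inter> Y = {}" using AW M by auto
      ultimately have "(A \<union> M) \<inter> bd A = {}" using A importantD(3)[of Y A "A \<union> M"] by blast
      then show "M \<subseteq> A" using M by (intro rooted_subset) auto
    qed
    show ?thesis
    proof (cases "bd M \<subseteq> W")
      case True
      have "A = M" if A: "A \<in> ?I Z W" for A
      proof -
        have "A \<inter> bd M = {}" using A True bd_disjoint[of A] by auto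
        then have "A \<subseteq> M" using A importantD(1) rooted_subset by blast
        with sub[OF A] show ?thesis by simp
      qed
      then have "card (?I Z W) \<le> card {M}" by (intro card_mono) auto
      also have "\<dots> \<le> 2 ^ p" by simp
      finally show ?thesis .
    next
      case False
      then obtain v where v: "v \<in> bd M" "v \<notin> W" by auto
      have "d \<noteq> 0" using M(2) v by (auto simp: card_gt_0_iff)
      \<comment> \<open>With \<open>p = 0\<close> one would get
        \<open>2 * (k - card W) \<le> d\<close>, against
        \<open>0 < d \<le> k - card W\<close>.\<close>
      have "d \<le> card (bd A0 - W)" using C0 by (intro dle) auto
      also have "\<dots> = card (bd A0) - card W"
        using A0 less.prems(1) by (intro card_Diff_subset) auto
      finally have "d \<le> k - card W" using A0 by auto
      with less.prems(4) \<open>l \<le> d\<close> \<open>d \<noteq> 0\<close> obtain q where q: "p = Suc q"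
        by (cases p) auto
      have cW: "card (insert v W) = Suc (card W)" using v less.prems(1) by simp
      \<comment> \<open>Case \<open>v \<in> bd A\<close>: the connectivity bound becomes
        \<open>d - 1\<close>, but \<open>2 * card W\<close> grows by two, so \<open>p\<close> can
        drop by one.\<close>
      have "card (?I M (insert v W)) \<le> 2 ^ q"
      proof (rule less.IH)
        show "d - 1 \<le> card (bd B - insert v W)"
          if "M \<subseteq> B" "B \<inter> Y = {}" "B \<inter> insert v W = {}" for B
        proof -
          have "d \<le> card (bd B - W)" using that M by (intro dle) auto
          then show ?thesis
            using card_Diff_insert[of v "bd B" W] card_Diff1_le[of "bd B - W" v]
              diff_card_le_card_Diff[of "{v}" "bd B - W"]
            by (simp add: Diff_insert[of _ v W])
        qed
      qed (use q cW less.prems \<open>l \<le> d\<close> \<open>d \<noteq> 0\<close> M in auto)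
      \<comment> \<open>Case \<open>v \<in> A\<close>: by maximality of \<open>M\<close> the
        connectivity bound rises to \<open>Suc d\<close>.\<close>
      moreover have "card (?I (insert v M) W) \<le> 2 ^ q"
      proof (rule less.IH)
        show "rooted (insert v M)" using M v by (intro rooted_insert) auto
        show "Suc d \<le> card (bd B - W)"
          if B: "insert v M \<subseteq> B" "B \<inter> Y = {}" "B \<inter> W = {}" for B
        proof (rule ccontr)
          assume nle: "\<not> ?thesis"
          let ?B = "root_component B"
          have sub': "insert v M \<subseteq> ?B"
            using B M v by (intro rooted_subset_root_component rooted_insert) auto
          have C: "?C ?B"
          proof (intro conjI)
            show "Z \<subseteq> ?B" using M sub' by auto
            show "?B \<inter> Y = {}" "?B \<inter> W = {}" using B root_component_subset[of B] by auto
          qed (rule rooted_root_component)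
          have "card (bd ?B - W) \<le> card (bd B - W)"
            using bd_root_component_subset[of B] by (intro card_mono) auto
          moreover have "d \<le> card (bd ?B - W)" using C by (intro dle) auto
          ultimately have "card (bd ?B - W) = d" using nle by linarith
          then have "M = ?B" using max[of ?B] C sub' by (auto simp: N_def)
          then show False using sub' v bd_disjoint[of M] by auto
        qed
      qed (use q less.prems \<open>l \<le> d\<close> in auto)
      moreover have "?I Z W \<subseteq> ?I M (insert v W) \<union> ?I (insert v M) W"
      proof
        fix A assume A: "A \<in> ?I Z W"
        have "v \<in> A \<union> bd A" using bd_mono[OF sub[OF A]] v by auto
        then show "A \<in> ?I M (insert v W) \<union> ?I (insert v M) W"
          using A sub[OF A] by auto
      qed
      then have "card (?I Z W) \<le> card (?I M (insert v W)) + card (?I (insert v M) W)"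
        by (rule order.trans[OF card_mono card_Un_le, rotated]) (intro finite_UnI fin)
      ultimately show ?thesis by (simp add: q)
    qed
  qed (metis card.empty zero_le)
qed

text \<open>Branching starts with nothing fixed and \<open>l = 0\<close>, so
  \<open>p = 2 * k\<close>.\<close>

lemma card_important_le: "card {A. important Y A \<and> card (bd A) \<le> k} \<le> 4 ^ k"
proof -
  have "card {A. important Y A \<and> {} \<subseteq> A \<and> {} \<subseteq> bd A \<and> card (bd A) \<le> k} \<le> 2 ^ (2 * k)"
    by (rule card_important_branching[where l = 0]) (auto simp: rooted_empty)
  then show ?thesis by (simp add: power_mult)
qed

text \<open>An inclusion-maximal admissible rooted superset works: the root component of a violating
  \<open>B\<close> would again be admissible, hence equal to \<open>A\<close>, although
  \<open>B\<close> meets \<open>bd A\<close>.\<close>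

lemma important_superset_exists:
  assumes "rooted R" "R \<inter> Y = {}"
  obtains A where "important Y A" "R \<subseteq> A" "card (bd A) \<le> card (bd R)"
proof -
  define N where "N = {A. rooted A \<and> R \<subseteq> A \<and> A \<inter> Y = {} \<and> card (bd A) \<le> card (bd R)}"
  have "finite N" by (rule finite_subset[OF _ finite_rooted]) (auto simp: N_def)
  moreover have "N \<noteq> {}" using assms by (auto simp: N_def)
  ultimately obtain A where "A \<in> N" and max: "\<And>B. B \<in> N \<Longrightarrow> A \<subseteq> B \<Longrightarrow> A = B"
    using finite_has_maximal[of N] by blast
  then have A: "rooted A" "R \<subseteq> A" "A \<inter> Y = {}" "card (bd A) \<le> card (bd R)"
    by (auto simp: N_def)
  have "card (bd A) < card (bd B)" if B: "A \<subseteq> B" "B \<inter> Y = {}" "B \<inter> bd A \<noteq> {}" for B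
  proof (rule ccontr)
    assume "\<not> card (bd A) < card (bd B)"
    moreover have "card (bd (root_component B)) \<le> card (bd B)"
      by (intro card_mono bd_root_component_subset) simp
    moreover have sub: "A \<subseteq> root_component B"
      using A B by (intro rooted_subset_root_component) auto
    ultimately have "card (bd (root_component B)) \<le> card (bd R)" using A(4) by linarith
    moreover have "R \<subseteq> root_component B" using A(2) sub by (rule order.trans)
    moreover have "root_component B \<inter> Y = {}" using B(2) root_component_subset[of B] by auto
    ultimately have "root_component B \<in> N"
      using rooted_root_component[of B] by (simp add: N_def)
    then have "A = root_component B" using sub by (rule max)
    then show False using B bd_root_component_disjoint[of B] by auto
  qed
  then have "important Y A" using A(1,3) unfolding important_def by blast
  then show thesis using A by (intro that)
qed

section \<open>Few labels suffice to certify importance\<close>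

text \<open>For an inclusion-minimal \<open>X'\<close>, dropping a label \<open>x\<close> yields a
  violating set \<open>B x\<close>. Adding these sets to \<open>A\<close> one at a time strictly
  lowers a potential that starts at no more than \<open>2 * card (bd A)\<close>.\<close>

lemma important_few_labels:
  fixes f :: "'v \<Rightarrow> 'l set"
  assumes "finite X" "important {v. f v \<inter> X \<noteq> {}} A"
  obtains X' where "X' \<subseteq> X" "card X' \<le> 2 * card (bd A)" "important {v. f v \<inter> X' \<noteq> {}} A"
proof -
  let ?Y = "\<lambda>X. {v. f v \<inter> X \<noteq> {}}"
  define N where "N = {X'. X' \<subseteq> X \<and> important (?Y X') A}"
  have "finite N" using assms(1) by (auto simp: N_def)
  moreover have "N \<noteq> {}" using assms(2) by (auto simp: N_def)
  ultimately obtain X' where "X' \<in> N" and minimal: "\<And>Z. Z \<in> N \<Longrightarrow> Z \<subseteq> X' \<Longrightarrow> X' = Z"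
    using finite_has_minimal[of N] by blast
  then have X': "X' \<subseteq> X" "important (?Y X') A" by (auto simp: N_def)
  have min: "X' = Z" if "Z \<subseteq> X'" "important (?Y Z) A" for Z
    using that X'(1) by (intro minimal) (auto simp: N_def)
  note imp = importantD[OF X'(2)]
  have "\<exists>B. A \<subseteq> B \<and> B \<inter> ?Y (X' - {x}) = {} \<and> B \<inter> bd A \<noteq> {} \<and> card (bd B) \<le> card (bd A)"
    if "x \<in> X'" for x
  proof -
    have "\<not> important (?Y (X' - {x})) A" using min[of "X' - {x}"] that by auto
    moreover have "A \<inter> ?Y (X' - {x}) = {}" using imp(2) by blast
    ultimately obtain B where "A \<subseteq> B" "B \<inter> ?Y (X' - {x}) = {}" "B \<inter> bd A \<noteq> {}"
      "\<not> card (bd A) < card (bd B)"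
      using imp(1) unfolding important_def by blast
    then show ?thesis by (auto simp: not_less)
  qed
  then obtain B where B: "\<And>x. x \<in> X' \<Longrightarrow> A \<subseteq> B x"
    "\<And>x. x \<in> X' \<Longrightarrow> B x \<inter> ?Y (X' - {x}) = {}" "\<And>x. x \<in> X' \<Longrightarrow> B x \<inter> bd A \<noteq> {}"
    "\<And>x. x \<in> X' \<Longrightarrow> card (bd (B x)) \<le> card (bd A)"
    by metis
  define U where "U F = A \<union> (\<Union>x\<in>F. B x)" for F
  text \<open>Adding \<open>B x\<close> to the union lowers its boundary size or covers a new vertex of \<open>bd A\<close>.\<close>
  have potential: "card (bd (U F)) + card (bd A - U F) + card F \<le> 2 * card (bd A)"
    if "finite F" "F \<subseteq> X'" for F
    using that
  proof (induction F rule: finite_induct)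
    case empty
    have "card (bd A - A) \<le> card (bd A)" by (intro card_mono) auto
    then show ?case by (simp add: U_def)
  next
    case (insert x F)
    have x: "x \<in> X'" "F \<subseteq> X'" using insert.prems by auto
    have Ux: "U (insert x F) = U F \<union> B x" by (auto simp: U_def)
    have AU: "A \<subseteq> U F \<inter> B x" using B(1) x by (auto simp: U_def)
    \<comment> \<open>Of the labels in \<open>X'\<close>, vertices of \<open>B x\<close> carry at
      most \<open>x\<close>, those of \<open>B y\<close> at most \<open>y\<close>, and those of
      \<open>A\<close> none. As \<open>x \<notin> F\<close>, the overlap carries none.\<close>
    have free: "(U F \<inter> B x) \<inter> ?Y X' = {}"
    proof (intro equals0I)
      fix v assume v: "v \<in> (U F \<inter> B x) \<inter> ?Y X'"
      then obtain z where z: "z \<in> f v" "z \<in> X'" by auto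
      then have "z = x" using v B(2)[OF x(1)] by auto
      moreover have "v \<notin> A" using imp(2) v by auto
      then obtain y where y: "y \<in> F" "v \<in> B y" using v by (auto simp: U_def)
      then have "z = y" using z B(2)[of y] x by auto
      ultimately show False using y insert.hyps by auto
    qed
    have submod: "card (bd (U F \<inter> B x)) + card (bd (U F \<union> B x))
        \<le> card (bd (U F)) + card (bd A)"
      using card_bd_submodular[of "{}" "U F" "B x"] B(4)[OF x(1)] by simp
    have "card (bd (U F \<union> B x)) + card (bd A - (U F \<union> B x)) < card (bd (U F)) + card (bd A - U F)"
    \<comment> \<open>If the overlap meets \<open>bd A\<close>, importance makes its boundary larger
      than \<open>bd A\<close>, so the union has a smaller boundary than \<open>U F\<close>.
      Otherwise the vertices of \<open>bd A\<close> in \<open>B x\<close> lie outside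
      \<open>U F\<close>, and the second term drops.\<close>
    proof (cases "(U F \<inter> B x) \<inter> bd A = {}")
      case False
      have "card (bd A) < card (bd (U F \<inter> B x))" by (rule imp(3)[OF AU free False])
      moreover have "card (bd A - (U F \<union> B x)) \<le> card (bd A - U F)"
        by (intro card_mono) auto
      ultimately show ?thesis using submod by linarith
    next
      case True
      then have "bd A \<subseteq> bd (U F \<inter> B x)" using bd_mono[OF AU] by auto
      then have "card (bd A) \<le> card (bd (U F \<inter> B x))" by (intro card_mono) auto
      moreover have "card (bd A - (U F \<union> B x)) < card (bd A - U F)"
        using True B(3)[OF x(1)] by (intro psubset_card_mono) auto
      ultimately show ?thesis using submod by linarith
    qed
    then show ?case using insert by (simp add: Ux)
  qed
  have "card X' \<le> 2 * card (bd A)"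
    using potential[of X'] finite_subset[OF X'(1) assms(1)] by simp
  then show thesis using that X' by blast
qed

end

section \<open>Counting label sets\<close>

text \<open>For \<open>k = 1\<close> the bound fails when \<open>card L = r\<close>, so induction
  starts at 2. Then the earlier count and the new binomial coefficient are each at most half of
  \<open>r ^ Suc k\<close>.\<close>

lemma card_bounded_subsets_le:
  fixes L :: "'l set"
  assumes "finite L" "card L \<le> r" "r \<ge> 2" "k \<ge> 2"
  shows "card {X. X \<subseteq> L \<and> card X \<le> k} \<le> r ^ k"
proof -
  let ?S = "\<lambda>k. {X. X \<subseteq> L \<and> card X \<le> k}"
  have step_le: "card (?S (Suc k)) \<le> card (?S k) + (card L choose Suc k)" for k
  proof -
    have "?S (Suc k) = ?S k \<union> {X. X \<subseteq> L \<and> card X = Suc k}" by auto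
    then show ?thesis
      using card_Un_le[of "?S k"] n_subsets[OF assms(1), of "Suc k"] by metis
  qed
  have "?S 0 = {{}}" using finite_subset[OF _ assms(1)] by auto
  then have "card (?S 2) \<le> 1 + card L + (card L choose 2)"
    using step_le[of 0] step_le[of 1] by (simp add: numeral_2_eq_2)
  moreover have "2 * (card L choose 2) \<le> card L * (card L - 1)"
    by (simp only: choose_two times_div_less_eq_dividend)
  moreover have "card L * (card L - 1) + card L = card L * card L"
    by (cases "card L") auto
  ultimately have "2 * card (?S 2) \<le> 2 + card L + card L * card L" by linarith
  also have "\<dots> \<le> r + r + r * r"
    using assms(2,3) by (intro add_mono mult_mono) auto
  also have "\<dots> \<le> r * r + r * r" using mult_le_mono1[OF assms(3), of r] by linarith
  finally have base_le: "card (?S 2) \<le> r ^ 2" by (simp add: power2_eq_square)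
  show ?thesis using \<open>k \<ge> 2\<close>
  proof (induction k rule: dec_induct)
    case base
    show ?case by (rule base_le)
  next
    case (step k)
    have "(2::nat) \<le> fact (Suc k)"
      using fact_mono_nat[of 2 "Suc k"] step.hyps by (simp add: fact_2)
    then have "2 * (card L choose Suc k) \<le> (card L choose Suc k) * fact (Suc k)"
      by (metis mult.commute mult_le_mono1)
    also have "\<dots> \<le> card L ^ Suc k" by (rule binomial_fact_pow)
    also have "\<dots> \<le> r ^ Suc k" using assms(2) by (intro power_mono) auto
    finally have "2 * (card L choose Suc k) \<le> r ^ Suc k" .
    moreover have "2 * r ^ k \<le> r ^ Suc k" using \<open>r \<ge> 2\<close> by simp
    moreover have "card (?S (Suc k)) \<le> card (?S k) + (card L choose Suc k)" by (rule step_le)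
    ultimately show ?case using step.IH by linarith
  qed
qed

text \<open>The vectors lie in the product of the component images.\<close>

lemma card_map_image_le:
  fixes g :: "'s \<Rightarrow> 't \<Rightarrow> 'b"
  assumes "finite C" "\<And>t. t \<in> set T \<Longrightarrow> card ((\<lambda>S. g S t) ` C) \<le> b"
  shows "card ((\<lambda>S. map (g S) T) ` C) \<le> b ^ length T"
  using assms(2)
proof (induction T)
  case Nil
  show ?case by (simp add: image_constant_conv)
next
  case (Cons t T)
  let ?A = "(\<lambda>S. g S t) ` C" and ?B = "(\<lambda>S. map (g S) T) ` C"
  have "card ((\<lambda>S. map (g S) (t # T)) ` C) \<le> card ((\<lambda>(x, xs). x # xs) ` (?A \<times> ?B))"
    using assms(1) by (intro card_mono) auto
  also have "\<dots> \<le> card (?A \<times> ?B)" using assms(1) by (intro card_image_le) auto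
  also have "\<dots> = card ?A * card ?B" by (rule card_cartesian_product)
  also have "\<dots> \<le> b * b ^ length T" using Cons by (intro mult_mono) auto
  finally show ?case by simp
qed

text \<open>This places reachable sets in the boundary framework. If \<open>t \<in> S\<close>, the
  set is empty and its boundary \<open>{t}\<close> still lies in \<open>S\<close>.\<close>

lemma reach_verts_rooted:
  assumes "pair_graph G" "t \<in> pverts G" "S \<subseteq> pverts G"
  shows "rooted_digraph.rooted (parcs G) t (reach_verts G t S)"
    and "rooted_digraph.bd (parcs G) t (reach_verts G t S) \<subseteq> S"
proof -
  interpret pair_graph G by fact
  interpret rooted_digraph "parcs G" t by unfold_locales (rule pair_finite_arcs)
  let ?F = "pverts G - S" and ?E = "{e \<in> parcs G. fst e \<in> pverts G - S \<and> snd e \<in> pverts G - S}"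
  have R: "reach_verts G t S = {v. (t, v) \<in> rtrancl_on ?F ?E}"
    by (simp add: reach_verts_def reachable_def arcs_ends_conv)
  show "rooted (reach_verts G t S)"
    unfolding rooted_def
  proof (intro allI impI subsetI)
    fix C v
    assume C: "reach_verts G t S \<inter> bd C = {}" and v: "v \<in> reach_verts G t S"
    from v have "(t, v) \<in> rtrancl_on ?F ?E" by (simp add: R)
    then show "v \<in> C"
    proof (induction rule: rtrancl_on_induct)
      case base
      then have "t \<in> reach_verts G t S" by (simp add: R)
      then show ?case using C by (auto simp: bd_def)
    next
      case (step y z)
      then have "z \<in> reach_verts G t S" by (auto simp: R intro: rtrancl_on_into_rtrancl_on)
      then show ?case using C step by (auto simp: bd_def)
    qed
  qed
  show "bd (reach_verts G t S) \<subseteq> S"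
  proof
    fix v assume v: "v \<in> bd (reach_verts G t S)"
    show "v \<in> S"
    proof (rule ccontr)
      assume nS: "v \<notin> S"
      consider "v = t" | u where "u \<in> reach_verts G t S" "(u, v) \<in> parcs G"
        using v by (auto simp: bd_def)
      then have "v \<in> reach_verts G t S"
      proof cases
        case 1
        then show ?thesis using nS assms(2) by (simp add: R)
      next
        case 2
        have "v \<in> ?F" "u \<in> ?F"
          using nS in_arcsD2[OF 2(2)] 2(1) reach_verts_subset[of G t S] by auto
        then show ?thesis using 2 by (auto simp: R intro: rtrancl_on_into_rtrancl_on)
      qed
      then show False using v by (auto simp: bd_def)
    qed
  qed
qed

text \<open>A label set is recovered from a pair of \<open>X'\<close> and \<open>A\<close>: at most
  \<open>r ^ (2 * m)\<close> choices for \<open>X'\<close>, then at most \<open>4 ^ m\<close>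
  important sets \<open>A\<close>.\<close>

lemma card_reach_labels_le:
  fixes G :: "'v pair_pre_digraph" and L :: "'l set"
  assumes G: "labeled_graph G L f" and L: "card L \<le> r" and t: "t \<in> pverts G"
    and "r \<ge> 2" "m \<ge> 1"
  shows "card ((\<lambda>S. reach_labels G f t S) ` {S. S \<subseteq> pverts G \<and> card S \<le> m})
    \<le> r ^ (2 * m) * 4 ^ m"
proof -
  interpret pair_graph G using G by (simp add: labeled_graph_def)
  interpret rooted_digraph "parcs G" t by unfold_locales (rule pair_finite_arcs)
  have "finite L" and fL: "\<And>v. v \<in> pverts G \<Longrightarrow> f v \<subseteq> L"
    using G by (auto simp: labeled_graph_def)
  let ?Y = "\<lambda>X. {v. f v \<inter> X \<noteq> {}}"
  let ?X = "{X. X \<subseteq> L \<and> card X \<le> 2 * m}"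
  let ?I = "\<lambda>X. {A. important (?Y X) A \<and> card (bd A) \<le> m}"
  have finI: "finite (?I X)" for X
    by (rule finite_subset[OF _ finite_rooted]) (auto simp: important_def)
  have finX: "finite ?X" using \<open>finite L\<close> by auto
  have "reach_labels G f t S \<in> (\<Union>X\<in>?X. (\<lambda>A. \<Union>(f ` A)) ` ?I X)"
    if S: "S \<subseteq> pverts G" "card S \<le> m" for S
  proof -
    let ?R = "reach_verts G t S"
    note R = reach_verts_rooted[OF pair_graph_axioms t S(1)]
    define X where "X = L - \<Union>(f ` ?R)"
    have finS: "finite S" using S(1) pair_finite_verts finite_subset by blast
    obtain A where A: "important (?Y X) A" "?R \<subseteq> A" "card (bd A) \<le> card (bd ?R)"
      using important_superset_exists[OF R(1), of "?Y X"] unfolding X_def by blast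
    have m: "card (bd A) \<le> m" using A(3) card_mono[OF finS R(2)] S(2) by linarith
    obtain X' where X': "X' \<subseteq> X" "card X' \<le> 2 * card (bd A)" "important (?Y X') A"
      using important_few_labels[OF _ A(1)] \<open>finite L\<close> unfolding X_def by blast
    \<comment> \<open>Labels are known to lie in \<open>L\<close> only on vertices of
      \<open>G\<close>.\<close>
    have "A \<subseteq> pverts G"
      using rooted_subset_vertices[OF importantD(1)[OF A(1)]] t in_arcsD2 by fastforce
    moreover have "A \<inter> ?Y X = {}" by (rule importantD(2)[OF A(1)])
    ultimately have "\<Union>(f ` A) \<subseteq> \<Union>(f ` ?R)" using fL by (fastforce simp: X_def)
    then have "reach_labels G f t S = \<Union>(f ` A)"
      using A(2) by (auto simp: reach_labels_def)
    moreover have "X' \<in> ?X" using X' m by (auto simp: X_def)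
    moreover have "A \<in> ?I X'" using X' m by auto
    ultimately show ?thesis by blast
  qed
  then have "card ((\<lambda>S. reach_labels G f t S) ` {S. S \<subseteq> pverts G \<and> card S \<le> m})
      \<le> card (\<Union>X\<in>?X. (\<lambda>A. \<Union>(f ` A)) ` ?I X)"
    using finX finI by (intro card_mono) auto
  also have "\<dots> \<le> (\<Sum>X\<in>?X. card ((\<lambda>A. \<Union>(f ` A)) ` ?I X))"
    by (rule card_UN_le[OF finX])
  also have "\<dots> \<le> (\<Sum>X\<in>?X. 4 ^ m)"
    by (intro sum_mono order.trans[OF card_image_le[OF finI] card_important_le])
  also have "\<dots> = card ?X * 4 ^ m" by simp
  also have "\<dots> \<le> r ^ (2 * m) * 4 ^ m"
    using \<open>finite L\<close> L \<open>r \<ge> 2\<close> \<open>m \<ge> 1\<close> by (intro mult_right_mono card_bounded_subsets_le) auto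
  finally show ?thesis .
qed

section \<open>Combining the terminals\<close>

lemma kappa_le:
  assumes "m \<ge> 1" "r \<ge> 1"
  shows "kappa n m r \<le> (r ^ (m * (m + 3) div 2) * 4 ^ m) ^ n"
proof -
  have "kappa n m r \<in> cut_characteristic_counts n m r"
    unfolding kappa_def
    by (intro Max_in finite_cut_characteristic_counts cut_characteristic_counts_nonempty)
  then obtain G :: "nat pair_pre_digraph" and L :: "nat set" and f T
    where G: "labeled_graph G L f" and L: "card L \<le> r"
      and T: "set T \<subseteq> pverts G" "length T = n"
      and k: "kappa n m r = card (cut_characteristics G f m T)"
    by (auto simp: cut_characteristic_counts_def)
  show ?thesis
  \<comment> \<open>The count per terminal needs \<open>r \<ge> 2\<close>. For \<open>r = 1\<close>
    the trivial bound of 2 per terminal is below \<open>4 ^ m\<close>.\<close>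
  proof (cases "r = 1")
    case True
    have "kappa n m r \<le> (2 ^ r) ^ n"
      unfolding k by (rule card_cut_characteristics_le[OF G L T(2)])
    also have "(2 ^ r) ^ n \<le> (r ^ (m * (m + 3) div 2) * 4 ^ m) ^ n"
    proof (intro power_mono)
      have "(4::nat) ^ 1 \<le> 4 ^ m" using assms by (intro power_increasing) auto
      then show "2 ^ r \<le> r ^ (m * (m + 3) div 2) * 4 ^ m" using True by simp
    qed simp
    finally show ?thesis .
  next
    case False
    let ?C = "{S. S \<subseteq> pverts G \<and> card S \<le> m}"
    interpret pair_graph G using G by (simp add: labeled_graph_def)
    have "finite ?C" using pair_finite_verts by auto
    have "cut_characteristics G f m T = (\<lambda>S. map (\<lambda>t. reach_labels G f t S) T) ` ?C"
      by (auto simp: cut_characteristics_def cut_characteristic_def)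
    also have "card \<dots> \<le> (r ^ (2 * m) * 4 ^ m) ^ length T"
      using False assms T(1)
      by (intro card_map_image_le[OF \<open>finite ?C\<close>] card_reach_labels_le[OF G L]) auto
    also have "\<dots> \<le> (r ^ (m * (m + 3) div 2) * 4 ^ m) ^ length T"
    proof (intro power_mono mult_right_mono power_increasing)
      have "m * 4 \<le> m * (m + 3)" using assms by (intro mult_le_mono2) auto
      then show "2 * m \<le> m * (m + 3) div 2" by linarith
    qed (use assms in auto)
    finally show ?thesis by (simp add: k T(2))
  qed
qed

theorem theorem1:
  shows "(\<lambda>(n, m, r). real (kappa n m r))
           \<in> O[principal {(n, m, r). m \<ge> 1 \<and> r \<ge> 1}](\<lambda>(n, m, r). kappa_bound n m r)
         \<and> (\<forall>n m. m \<ge> 1 \<longrightarrow> (\<exists>p :: real poly. \<forall>r. kappa_bound n m r = poly p (real r)))"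
proof
  have "real (kappa n m r) \<le> kappa_bound n m r" if mr: "m \<ge> 1" "r \<ge> 1" for n m r
  proof -
    \<comment> \<open>Evenness makes the halving exact, so the factor \<open>n\<close> can leave the
      division.\<close>
    have "even (m * (m + 3))" by auto
    then have e: "n * m * (m + 3) div 2 = m * (m + 3) div 2 * n"
      by (metis div_mult_swap mult.assoc mult.commute)
    have "real (kappa n m r) \<le> real ((r ^ (m * (m + 3) div 2) * 4 ^ m) ^ n)"
      using kappa_le[OF mr] by (simp only: of_nat_le_iff)
    also have "\<dots> = real r ^ (m * (m + 3) div 2 * n) * 4 ^ (n * m)"
      by (simp add: power_mult_distrib power_mult mult.commute[of n m])
    also have "\<dots> \<le> real m ^ (2 * n) * (real r ^ (m * (m + 3) div 2 * n) * 4 ^ (n * m))"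
      using mr mult_right_mono[of 1 "real m ^ (2 * n)"] by simp
    also have "\<dots> = kappa_bound n m r"
      unfolding kappa_bound_def e by (rule mult.assoc[symmetric])
    finally show ?thesis .
  qed
  moreover have "kappa_bound n m r \<ge> 0" for n m r by (simp add: kappa_bound_def)
  ultimately show "(\<lambda>(n, m, r). real (kappa n m r))
      \<in> O[principal {(n, m, r). m \<ge> 1 \<and> r \<ge> 1}](\<lambda>(n, m, r). kappa_bound n m r)"
    by (intro bigoI[of _ 1]) (auto simp: eventually_principal)
  show "\<forall>n m. m \<ge> 1 \<longrightarrow> (\<exists>p :: real poly. \<forall>r. kappa_bound n m r = poly p (real r))"
  proof (intro allI impI exI)
    fix n m r :: nat
    show "kappa_bound n m r
        = poly (monom (real m ^ (2 * n) * 4 ^ (n * m)) (n * m * (m + 3) div 2)) (real r)"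
      by (simp add: kappa_bound_def poly_monom)
  qed
qed

end
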